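(* The following are necessary conditions for optimal deployments in the heterogeneous two-tier network with two-tier distortion $D$. Let $(P^*,Q^*,\mathbf{R}^*,T^* )$ be an optimal node deployment, i.e. a minimizer of $D(P,Q,\mathbf{R},T)$ over all AP deployments $P$, FC deployments $Q$, partitions $\mathbf{R}$ of $\Omega$ and index maps $T$. Write $v_n^*=\int_{R_n^*}f(w)\,dw$ and $c_n^*=\frac{\int_{R_n^*}wf(w)\,dw}{\int_{R_n^*}f(w)\,dw}$. Then, for every $n\in\{1,\dots,N\}$ and every $m\in\{1,\dots,M\}$, $$p_n^*=\frac{a_nc_n^*+\beta b_{n,T^*(n)}\,q^*_{T^*(n)}}{a_n+\beta b_{n,T^*(n)}},\qquad q_m^*=\frac{\sum_{n:T^*(n)=m}b_{n,m}\,p_n^*v_n^*}{\sum_{n:T^*(n)=m}b_{n,m}\,v_n^*}.$$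
   Context: Setting. $\Omega\subset\mathbb{R}^2$ is a convex polygon including its interior. $N\ge M\ge 1$ are integers; $\mathcal{I_A}=\{1,\dots,N\}$ indexes access points (APs) and $\mathcal{I_B}=\{1,\dots,M\}$ indexes fusion centers (FCs). $f:\Omega\to\mathbb{R}^+=(0,\infty)$ is a continuous and differentiable density. The constants $a_n>0$ ($n\in\mathcal{I_A}$), $b_{n,m}>0$ ($n\in\mathcal{I_A}$, $m\in\mathcal{I_B}$) and $\beta>0$ are given. $\|\cdot\|$ is the Euclidean norm. An AP deployment is $P=(p_1,\dots,p_N)$ with $p_n\in\mathbb{R}^2$; an FC deployment is $Q=(q_1,\dots,q_M)$ with $q_m\in\mathbb{R}^2$; an index map is a function $T:\mathcal{I_A}\to\mathcal{I_B}$; a partition of $\Omega$ is a tuple $\mathbf{R}=(R_1,\dots,R_N)$ of pairwise disjoint Borel sets with union $\Omega$. Components of $P^*,Q^*,\mathbf{R}^*$ are written $p_n^*,q_m^*,R_n^*$. The two-tier distortion is $$D(P,Q,\mathbf{R},T)=\sum_{n=1}^N\int_{R_n}\left(a_n\|p_n-w\|^2+\beta b_{n,T(n)}\|p_n-q_{T(n)}\|^2\right)f(w)\,dw .$$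
   Formalization: The formula for p_n^* is claimed only for those n with v_n^* nonzero, since c_n^* is undefined when v_n^* = 0, which can happen at an optimal deployment; the formula for q_m^* is claimed for every m. *)

theory Defs
  imports "HOL-Analysis.Analysis"
begin

definition convex_polygon :: "(real^2) set \<Rightarrow> bool" where
  "convex_polygon \<Omega> \<longleftrightarrow> polytope \<Omega> \<and> interior \<Omega> \<noteq> {}"

text \<open>Access points are indexed by \<open>{1..N}\<close> and fusion centers by \<open>{1..M}\<close>. Deployments,
  partitions and index maps are total functions on \<open>nat\<close> whose values outside the index range
  are never used; likewise the density is only evaluated on \<open>\<Omega>\<close>.\<close>

definition region_partition :: "nat \<Rightarrow> (real^2) set \<Rightarrow> (nat \<Rightarrow> (real^2) set) \<Rightarrow> bool" where
  "region_partition N \<Omega> R \<longleftrightarrow>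
     (\<forall>n\<in>{1..N}. R n \<in> sets borel) \<and>
     disjoint_family_on R {1..N} \<and>
     (\<Union>n\<in>{1..N}. R n) = \<Omega>"

definition two_tier_distortion ::
  "nat \<Rightarrow> (nat \<Rightarrow> real) \<Rightarrow> (nat \<Rightarrow> nat \<Rightarrow> real) \<Rightarrow> real \<Rightarrow> (real^2 \<Rightarrow> real) \<Rightarrow>
   (nat \<Rightarrow> real^2) \<Rightarrow> (nat \<Rightarrow> real^2) \<Rightarrow> (nat \<Rightarrow> (real^2) set) \<Rightarrow> (nat \<Rightarrow> nat) \<Rightarrow> real" where
  "two_tier_distortion N a b \<beta> f P Q R T =
     (\<Sum>n=1..N. LINT w:R n|lborel.
        (a n * (norm (P n - w))^2 + \<beta> * b n (T n) * (norm (P n - Q (T n)))^2) * f w)"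

definition optimal_deployment ::
  "nat \<Rightarrow> nat \<Rightarrow> (real^2) set \<Rightarrow> (nat \<Rightarrow> real) \<Rightarrow> (nat \<Rightarrow> nat \<Rightarrow> real) \<Rightarrow> real \<Rightarrow> (real^2 \<Rightarrow> real) \<Rightarrow>
   (nat \<Rightarrow> real^2) \<Rightarrow> (nat \<Rightarrow> real^2) \<Rightarrow> (nat \<Rightarrow> (real^2) set) \<Rightarrow> (nat \<Rightarrow> nat) \<Rightarrow> bool" where
  "optimal_deployment N M \<Omega> a b \<beta> f P Q R T \<longleftrightarrow>
     region_partition N \<Omega> R \<and> T \<in> {1..N} \<rightarrow> {1..M} \<and>
     (\<forall>P' Q' R' T'. region_partition N \<Omega> R' \<and> T' \<in> {1..N} \<rightarrow> {1..M} \<longrightarrow>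
        two_tier_distortion N a b \<beta> f P Q R T \<le> two_tier_distortion N a b \<beta> f P' Q' R' T')"

definition region_mass :: "(real^2 \<Rightarrow> real) \<Rightarrow> (real^2) set \<Rightarrow> real" where
  "region_mass f A = (LINT w:A|lborel. f w)"

definition region_centroid :: "(real^2 \<Rightarrow> real) \<Rightarrow> (real^2) set \<Rightarrow> real^2" where
  "region_centroid f A = (LINT w:A|lborel. f w *\<^sub>R w) /\<^sub>R (LINT w:A|lborel. f w)"

end

theory Submission
  imports Defs
begin

text \<open>Freezing the partition and the index map, the distortion is a quadratic function of each
  \<open>p\<^sub>n\<close> and of each \<open>q\<^sub>m\<close>, and completing the square identifies the minimizer, provided that the
  leading coefficient is nonzero. For \<open>q\<^sub>m\<close> this means that some AP with a region of positive mass
  is assigned to \<open>m\<close>. Suppose not. If some AP \<open>k\<close> has a null region, put \<open>p\<^sub>k = q\<^sub>m\<close> at a point of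
  \<open>\<Omega>\<close> away from all APs and hand \<open>k\<close> a small neighbourhood of it: the distortion drops. Otherwise
  two APs \<open>k, k'\<close> share an FC by the pigeonhole principle. Reassigning either one to \<open>m\<close> with
  \<open>q\<^sub>m\<close> on top of it would save its second-tier cost, so both lie on their common FC. Merging the
  regions of \<open>k\<close> and \<open>k'\<close> in favour of the one with the smaller weight \<open>a\<close> then does not increase
  the distortion and makes a region null, which is the first case.\<close>

section \<open>Quadratic functions on an inner product space\<close>

text \<open>Completing the square: the value at \<open>x\<close> exceeds the value at
  \<open>B /\<^sub>R A\<close> by exactly \<open>A * (norm (x - B /\<^sub>R A))^2\<close>, so
  testing minimality against that single point suffices.\<close>

lemma quadratic_minimizer_eq:
  fixes x B :: "'a::real_inner" and A :: real
  assumes "0 < A"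
    and min: "\<And>p. A * (norm x)^2 - 2 * (x \<bullet> B) \<le> A * (norm p)^2 - 2 * (p \<bullet> B)"
  shows "x = B /\<^sub>R A"
proof -
  have "A * (norm (x - B /\<^sub>R A))^2
      = (A * (norm x)^2 - 2 * (x \<bullet> B)) - (A * (norm (B /\<^sub>R A))^2 - 2 * ((B /\<^sub>R A) \<bullet> B))"
    using assms(1)
    unfolding power2_norm_eq_inner inner_diff_left inner_diff_right inner_scaleR_left inner_scaleR_right
    by (simp add: inner_commute[of B x] field_simps)
  also have "\<dots> \<le> 0" using min[of "B /\<^sub>R A"] by simp
  finally have "(norm (x - B /\<^sub>R A))^2 \<le> 0"
    using \<open>0 < A\<close> by (simp add: mult_le_0_iff)
  then show ?thesis by simp
qed

text \<open>Brings the total second-tier cost of an FC at \<open>q\<close> into the shape of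
  \<open>quadratic_minimizer_eq\<close>; the last sum is constant in \<open>q\<close>.\<close>

lemma weighted_sum_norm_diff_sq:
  fixes p :: "'i \<Rightarrow> 'a::real_inner"
  shows "(\<Sum>k\<in>K. c k * (norm (p k - q))^2)
    = (\<Sum>k\<in>K. c k) * (norm q)^2 - 2 * (q \<bullet> (\<Sum>k\<in>K. c k *\<^sub>R p k)) + (\<Sum>k\<in>K. c k * (norm (p k))^2)"
proof -
  have "(\<Sum>k\<in>K. c k * (norm (p k - q))^2)
    = (\<Sum>k\<in>K. c k * (norm q)^2 - 2 * (c k * (q \<bullet> p k)) + c k * (norm (p k))^2)"
    by (intro sum.cong refl)
       (simp add: power2_norm_eq_inner inner_diff_left inner_diff_right inner_commute algebra_simps)
  then show ?thesis
    by (simp add: sum.distrib sum_subtractf sum_distrib_right sum_distrib_left inner_sum_right)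
qed

text \<open>Compactness and continuity make every integral below finite; the nonempty interior
  leaves room for a new AP away from all existing ones.\<close>

locale two_tier_network =
  fixes N M :: nat and \<Omega> :: "(real^2) set" and f :: "real^2 \<Rightarrow> real"
    and a :: "nat \<Rightarrow> real" and b :: "nat \<Rightarrow> nat \<Rightarrow> real" and \<beta> :: real
  assumes M_le_N: "M \<le> N"
    and compact_\<Omega>: "compact \<Omega>" and interior_\<Omega>: "interior \<Omega> \<noteq> {}"
    and cont_f: "continuous_on \<Omega> f"
    and f_pos: "\<And>w. w \<in> \<Omega> \<Longrightarrow> 0 < f w"
    and a_pos: "\<And>n. n \<in> {1..N} \<Longrightarrow> 0 < a n"
    and b_pos: "\<And>n m. n \<in> {1..N} \<Longrightarrow> m \<in> {1..M} \<Longrightarrow> 0 < b n m"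
    and \<beta>_pos: "0 < \<beta>"
begin

section \<open>Integration against the density\<close>

abbreviation region :: "(real^2) set \<Rightarrow> bool" where
  "region A \<equiv> A \<in> sets borel \<and> A \<subseteq> \<Omega>"

abbreviation weighted :: "(real^2) set \<Rightarrow> (real^2 \<Rightarrow> real) \<Rightarrow> real" where
  "weighted A g \<equiv> LINT w:A|lborel. g w * f w"

text \<open>Vector-valued \<open>g\<close> is allowed so that the first moment of a region is
  covered too.\<close>

lemma set_integrable_density:
  fixes g :: "real^2 \<Rightarrow> 'b::euclidean_space"
  assumes "region A" and g: "continuous_on UNIV g"
  shows "set_integrable lborel A (\<lambda>w. f w *\<^sub>R g w)"
proof (rule set_integrable_subset)
  have "continuous_on \<Omega> (\<lambda>w. f w *\<^sub>R g w)"
    using cont_f continuous_on_subset[OF g] by (intro continuous_intros) auto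
  then show "set_integrable lborel \<Omega> (\<lambda>w. f w *\<^sub>R g w)"
    unfolding set_integrable_def by (rule borel_integrable_compact[OF compact_\<Omega>])
qed (use assms in auto)

lemma set_integrable_weighted:
  assumes "region A" and "continuous_on UNIV g"
  shows "set_integrable lborel A (\<lambda>w. g w * f w)"
  using set_integrable_density[OF assms] by (simp add: mult.commute)

lemma set_integrable_f: "region A \<Longrightarrow> set_integrable lborel A f"
  using set_integrable_weighted[of A "\<lambda>_. 1"] by simp

lemma weighted_null:
  assumes "A \<in> null_sets lborel"
  shows "weighted A g = 0"
  unfolding set_lebesgue_integral_def
  by (rule integral_eq_zero_AE, rule eventually_mono[OF AE_not_in[OF assms]]) simp

lemma weighted_Un:
  assumes "region A" "region B" "A \<inter> B = {}" "continuous_on UNIV g"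
  shows "weighted (A \<union> B) g = weighted A g + weighted B g"
  using assms by (intro set_integral_Un set_integrable_weighted) auto

lemma weighted_mono:
  assumes "region A" "continuous_on UNIV g" "continuous_on UNIV h"
    and "\<And>w. w \<in> A \<Longrightarrow> g w \<le> h w"
  shows "weighted A g \<le> weighted A h"
proof (intro set_integral_mono set_integrable_weighted)
  show "g w * f w \<le> h w * f w" if "w \<in> A" for w
    using assms(1,4) f_pos[of w] that by (intro mult_right_mono) auto
qed (use assms in auto)

text \<open>The difference of the integrands is strictly positive on \<open>A\<close>; were its
  integral zero, almost every point would lie outside \<open>A\<close>.\<close>

lemma weighted_strict_mono:
  assumes A: "region A" and g: "continuous_on UNIV g" and h: "continuous_on UNIV h"
    and less: "\<And>w. w \<in> A \<Longrightarrow> g w < h w"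
    and nonnull: "A \<notin> null_sets lborel"
  shows "weighted A g < weighted A h"
proof -
  let ?d = "\<lambda>w. (h w - g w) * f w"
  have int: "set_integrable lborel A ?d"
    using A g h by (intro set_integrable_weighted continuous_intros)
  have pos: "0 < ?d w" if "w \<in> A" for w
    using that less f_pos A by auto
  then have nonneg: "0 \<le> indicator A w *\<^sub>R ?d w" for w
    by (cases "w \<in> A") (auto simp: less_imp_le simp del: zero_less_mult_iff)
  have "weighted A (\<lambda>w. h w - g w) \<noteq> 0"
  proof
    assume "weighted A (\<lambda>w. h w - g w) = 0"
    then have "AE w in lborel. indicator A w *\<^sub>R ?d w = 0"
      using int nonneg unfolding set_lebesgue_integral_def set_integrable_def
      by (subst (asm) integral_nonneg_eq_0_iff_AE) auto
    then have "AE w in lborel. w \<notin> A"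
    proof (rule eventually_mono)
      show "w \<notin> A" if "indicator A w *\<^sub>R ?d w = 0" for w
        using that pos[of w] by (metis indicator_simps(1) less_irrefl scaleR_one)
    qed
    then show False
      using nonnull A by (simp add: AE_iff_null_sets)
  qed
  moreover have "0 \<le> weighted A (\<lambda>w. h w - g w)"
    using nonneg unfolding set_lebesgue_integral_def by (intro integral_nonneg_AE) auto
  moreover have "weighted A (\<lambda>w. h w - g w) = weighted A h - weighted A g"
    using A g h by (simp add: left_diff_distrib set_integrable_weighted)
  ultimately show ?thesis by linarith
qed

text \<open>Positivity of \<open>f\<close> lets the argument switch between mass, which occurs in
  the formulas, and null sets, which suit the exchange arguments.\<close>

lemma region_mass_pos_iff:
  assumes "region A"
  shows "0 < region_mass f A \<longleftrightarrow> A \<notin> null_sets lborel"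
proof
  show "A \<notin> null_sets lborel" if "0 < region_mass f A"
    using that weighted_null[of A "\<lambda>_. 1"] unfolding region_mass_def by auto
  show "0 < region_mass f A" if "A \<notin> null_sets lborel"
    using weighted_strict_mono[of A "\<lambda>_. 0" "\<lambda>_. 1"] assms that unfolding region_mass_def by simp
qed

lemma region_mass_nonneg: "region A \<Longrightarrow> 0 \<le> region_mass f A"
  using weighted_mono[of A "\<lambda>_. 0" "\<lambda>_. 1"] unfolding region_mass_def by simp

section \<open>Cost of a single AP and its moments\<close>

text \<open>The density is kept out, so that \<open>cost\<close> is continuous on the whole plane,
  while \<open>f\<close> is controlled only on \<Omega>.\<close>

definition cost :: "(nat \<Rightarrow> real^2) \<Rightarrow> (nat \<Rightarrow> real^2) \<Rightarrow> (nat \<Rightarrow> nat) \<Rightarrow> nat \<Rightarrow> real^2 \<Rightarrow> real" where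
  "cost P Q T n w = a n * (norm (P n - w))^2 + \<beta> * b n (T n) * (norm (P n - Q (T n)))^2"

lemma continuous_cost [continuous_intros]: "continuous_on UNIV (cost P Q T n)"
  unfolding cost_def[abs_def] by (intro continuous_intros)

lemma distortion_eq:
  "two_tier_distortion N a b \<beta> f P Q R T = (\<Sum>n=1..N. weighted (R n) (cost P Q T n))"
  unfolding two_tier_distortion_def cost_def ..

text \<open>The second-tier term is constant in \<open>w\<close>, so it integrates to a multiple of
  the mass.\<close>

lemma weighted_cost_eq:
  assumes "region A"
  shows "weighted A (cost P Q T n) = a n * weighted A (\<lambda>w. (norm (P n - w))^2)
    + \<beta> * b n (T n) * (norm (P n - Q (T n)))^2 * region_mass f A"
proof -
  have "weighted A (cost P Q T n) = (LINT w:A|lborel. a n * ((norm (P n - w))^2 * f w)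
    + \<beta> * b n (T n) * (norm (P n - Q (T n)))^2 * f w)"
    unfolding cost_def by (simp add: algebra_simps)
  also have "\<dots> = (LINT w:A|lborel. a n * ((norm (P n - w))^2 * f w))
    + (LINT w:A|lborel. \<beta> * b n (T n) * (norm (P n - Q (T n)))^2 * f w)"
    using assms
    by (intro set_integral_add set_integrable_mult_right set_integrable_weighted set_integrable_f
        continuous_intros)
  finally show ?thesis by (simp add: region_mass_def)
qed

text \<open>Expanding the square shows a quadratic in \<open>p\<close> whose leading coefficient is
  the mass and whose linear part is the first moment.\<close>

lemma weighted_norm_diff_sq:
  assumes A: "region A"
  shows "weighted A (\<lambda>w. (norm (p - w))^2) = region_mass f A * (norm p)^2
    - 2 * (p \<bullet> (LINT w:A|lborel. f w *\<^sub>R w)) + weighted A (\<lambda>w. (norm w)^2)"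
proof -
  have first: "set_integrable lborel A (\<lambda>w. f w *\<^sub>R w)"
    using A by (intro set_integrable_density continuous_intros)
  have inner: "(LINT w:A|lborel. p \<bullet> (f w *\<^sub>R w)) = p \<bullet> (LINT w:A|lborel. f w *\<^sub>R w)"
    using integral_inner_right[of p lborel "\<lambda>w. indicator A w *\<^sub>R f w *\<^sub>R w"] first
    unfolding set_lebesgue_integral_def set_integrable_def by (simp add: mult.assoc)
  have inner_int: "set_integrable lborel A (\<lambda>w. p \<bullet> (f w *\<^sub>R w))"
    using set_integrable_weighted[OF A, of "\<lambda>w. p \<bullet> w"]
    by (simp add: mult.commute continuous_intros)
  have sq: "set_integrable lborel A (\<lambda>w. (norm w)^2 * f w)"
    using A by (intro set_integrable_weighted continuous_intros)
  have mass: "set_integrable lborel A (\<lambda>w. (norm p)^2 * f w)"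
    using A by (intro set_integrable_weighted continuous_intros)
  have "weighted A (\<lambda>w. (norm (p - w))^2)
    = (LINT w:A|lborel. ((norm p)^2 * f w - 2 * (p \<bullet> (f w *\<^sub>R w))) + (norm w)^2 * f w)"
    by (simp add: power2_norm_eq_inner inner_diff_left inner_diff_right inner_commute algebra_simps)
  also have "\<dots> = (LINT w:A|lborel. (norm p)^2 * f w) - (LINT w:A|lborel. 2 * (p \<bullet> (f w *\<^sub>R w)))
      + weighted A (\<lambda>w. (norm w)^2)"
    using sq mass inner_int by simp
  finally show ?thesis
    by (simp add: inner region_mass_def mult.commute del: inner_scaleR_right)
qed

section \<open>Optimality equations for APs and FCs\<close>

lemma partition_region:
  "region_partition N \<Omega> R \<Longrightarrow> n \<in> {1..N} \<Longrightarrow> region (R n)"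
  unfolding region_partition_def by blast

lemma optimalD:
  assumes "optimal_deployment N M \<Omega> a b \<beta> f P Q R T"
  shows "region_partition N \<Omega> R" and "T \<in> {1..N} \<rightarrow> {1..M}"
    and "region_partition N \<Omega> R' \<Longrightarrow> T' \<in> {1..N} \<rightarrow> {1..M} \<Longrightarrow>
      two_tier_distortion N a b \<beta> f P Q R T \<le> two_tier_distortion N a b \<beta> f P' Q' R' T'"
  using assms unfolding optimal_deployment_def by blast+

lemma sum_remove_AP:
  fixes g :: "nat \<Rightarrow> real"
  shows "n \<in> {1..N} \<Longrightarrow> (\<Sum>i=1..N. g i) = g n + (\<Sum>i\<in>{1..N} - {n}. g i)"
  by (rule sum.remove) auto

text \<open>The partition stays fixed, so the unchanged summands cancel when the two distortions are
  compared.\<close>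

lemma optimal_weighted_le:
  assumes opt: "optimal_deployment N M \<Omega> a b \<beta> f P Q R T" and n: "n \<in> {1..N}"
    and T': "T' \<in> {1..N} \<rightarrow> {1..M}"
    and same: "\<And>i. i \<in> {1..N} - {n} \<Longrightarrow>
      weighted (R i) (cost P' Q' T' i) = weighted (R i) (cost P Q T i)"
  shows "weighted (R n) (cost P Q T n) \<le> weighted (R n) (cost P' Q' T' n)"
proof -
  have "(\<Sum>i\<in>{1..N} - {n}. weighted (R i) (cost P' Q' T' i))
      = (\<Sum>i\<in>{1..N} - {n}. weighted (R i) (cost P Q T i))"
    using same by (rule sum.cong[OF refl])
  then show ?thesis
    using optimalD(3)[OF opt optimalD(1)[OF opt] T', of P' Q']
    unfolding distortion_eq sum_remove_AP[OF n] by linarith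
qed

text \<open>Moving \<open>P n\<close> alone changes only the \<open>n\<close>-th summand, a
  quadratic in the position with leading coefficient \<open>(a n + c) * v\<close>, which is positive
  by the mass assumption.\<close>

lemma optimal_AP_eq:
  assumes opt: "optimal_deployment N M \<Omega> a b \<beta> f P Q R T" and n: "n \<in> {1..N}"
    and mass: "region_mass f (R n) \<noteq> 0"
  shows "P n = (a n *\<^sub>R region_centroid f (R n) + (\<beta> * b n (T n)) *\<^sub>R Q (T n))
    /\<^sub>R (a n + \<beta> * b n (T n))"
proof -
  have R: "region (R n)" using partition_region optimalD(1)[OF opt] n by blast
  define v S c where "v = region_mass f (R n)" and "S = (LINT w:R n|lborel. f w *\<^sub>R w)"
    and "c = \<beta> * b n (T n)"
  have v: "0 < v" using region_mass_nonneg[OF R] mass v_def by simp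
  have "T n \<in> {1..M}" using optimalD(2)[OF opt] n by blast
  then have c: "0 < c" using b_pos n \<beta>_pos c_def by simp
  have an: "0 < a n" using a_pos n .
  have le: "weighted (R n) (cost P Q T n) \<le> weighted (R n) (cost (P(n := p)) Q T n)" for p
    using opt n optimalD(2)[OF opt] by (rule optimal_weighted_le) (simp add: cost_def)
  have eq: "weighted (R n) (cost (P(n := p)) Q T n)
     = (((a n + c) * v) * (norm p)^2 - 2 * (p \<bullet> (a n *\<^sub>R S + (c * v) *\<^sub>R Q (T n))))
       + (a n * weighted (R n) (\<lambda>w. (norm w)^2) + c * v * (norm (Q (T n)))^2)" for p
    unfolding weighted_cost_eq[OF R] weighted_norm_diff_sq[OF R] fun_upd_same
      v_def[symmetric] S_def[symmetric] c_def[symmetric]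
    by (simp add: power2_norm_eq_inner inner_diff_left inner_diff_right inner_add_right
        inner_commute algebra_simps)
  have "P n = (a n *\<^sub>R S + (c * v) *\<^sub>R Q (T n)) /\<^sub>R ((a n + c) * v)"
  proof (rule quadratic_minimizer_eq)
    show "0 < (a n + c) * v" using an c v by simp
    show "(a n + c) * v * (norm (P n))^2 - 2 * (P n \<bullet> (a n *\<^sub>R S + (c * v) *\<^sub>R Q (T n)))
      \<le> (a n + c) * v * (norm p)^2 - 2 * (p \<bullet> (a n *\<^sub>R S + (c * v) *\<^sub>R Q (T n)))" for p
      using le[of p] eq[of p] eq[of "P n"] by simp
  qed
  \<comment> \<open>The mass \<open>v\<close> cancels, turning the first moment \<open>S\<close>
    into the centroid.\<close>
  also have "\<dots> = (a n *\<^sub>R (S /\<^sub>R v) + c *\<^sub>R Q (T n)) /\<^sub>R (a n + c)"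
  proof -
    have "inverse ((a n + c) * v) * (c * v) = inverse (a n + c) * c"
      using v by simp
    then show ?thesis by (simp add: scaleR_add_right mult_ac)
  qed
  finally show ?thesis
    unfolding region_centroid_def S_def v_def c_def region_mass_def .
qed

text \<open>Moving \<open>Q m\<close> affects only the second-tier cost of the APs assigned to
  \<open>m\<close>; the AP \<open>j\<close> of positive mass makes the leading coefficient
  positive.\<close>

lemma optimal_FC_eq:
  assumes opt: "optimal_deployment N M \<Omega> a b \<beta> f P Q R T"
    and m: "m \<in> {1..M}" and j: "j \<in> {1..N}" "T j = m" "region_mass f (R j) \<noteq> 0"
  shows "Q m = (\<Sum>k | k \<in> {1..N} \<and> T k = m. (b k m * region_mass f (R k)) *\<^sub>R P k)
    /\<^sub>R (\<Sum>k | k \<in> {1..N} \<and> T k = m. b k m * region_mass f (R k))"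
proof -
  \<comment> \<open>The weights \<open>c\<close> omit \<beta>, a common positive factor that does
    not affect the minimizer.\<close>
  define K c where "K = {k \<in> {1..N}. T k = m}" and "c = (\<lambda>k. b k m * region_mass f (R k))"
  have R: "region (R k)" if "k \<in> {1..N}" for k
    using partition_region optimalD(1)[OF opt] that by blast
  have c_nonneg: "0 \<le> c k" if "k \<in> K" for k
    using that b_pos[OF _ m, of k] region_mass_nonneg[OF R, of k] by (auto simp: K_def c_def)
  have "0 < c j"
    using j b_pos[OF j(1) m] region_mass_nonneg[OF R[OF j(1)]] by (auto simp: c_def)
  then have pos: "0 < sum c K"
    using j c_nonneg by (intro sum_pos2[of K j]) (auto simp: K_def)
  have split: "two_tier_distortion N a b \<beta> f P (Q(m := q)) R T
    = (\<Sum>k\<in>{1..N} - K. weighted (R k) (cost P Q T k))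
      + (\<Sum>k\<in>K. a k * weighted (R k) (\<lambda>w. (norm (P k - w))^2))
      + \<beta> * (\<Sum>k\<in>K. c k * (norm (P k - q))^2)" for q
  proof -
    have "two_tier_distortion N a b \<beta> f P (Q(m := q)) R T
      = (\<Sum>k\<in>{1..N} - K. weighted (R k) (cost P (Q(m := q)) T k))
        + (\<Sum>k\<in>K. weighted (R k) (cost P (Q(m := q)) T k))"
      unfolding distortion_eq by (rule sum.subset_diff) (auto simp: K_def)
    moreover have "(\<Sum>k\<in>{1..N} - K. weighted (R k) (cost P (Q(m := q)) T k))
        = (\<Sum>k\<in>{1..N} - K. weighted (R k) (cost P Q T k))"
      by (intro sum.cong refl) (auto simp: K_def cost_def)
    moreover have "(\<Sum>k\<in>K. weighted (R k) (cost P (Q(m := q)) T k))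
      = (\<Sum>k\<in>K. a k * weighted (R k) (\<lambda>w. (norm (P k - w))^2) + \<beta> * (c k * (norm (P k - q))^2))"
    proof (intro sum.cong refl)
      fix k assume "k \<in> K"
      then have "region (R k)" and "T k = m" using R by (auto simp: K_def)
      then show "weighted (R k) (cost P (Q(m := q)) T k)
        = a k * weighted (R k) (\<lambda>w. (norm (P k - w))^2) + \<beta> * (c k * (norm (P k - q))^2)"
        by (subst weighted_cost_eq) (auto simp: c_def)
    qed
    ultimately show ?thesis by (simp add: sum.distrib sum_distrib_left)
  qed
  have "(\<Sum>k\<in>K. c k * (norm (P k - Q m))^2) \<le> (\<Sum>k\<in>K. c k * (norm (P k - q))^2)" for q
    using optimalD(3)[OF opt optimalD(1,2)[OF opt], of P "Q(m := q)"] split[of q] split[of "Q m"]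
      \<beta>_pos by simp
  then have "Q m = (\<Sum>k\<in>K. c k *\<^sub>R P k) /\<^sub>R sum c K"
    using pos by (intro quadratic_minimizer_eq) (auto simp: weighted_sum_norm_diff_sq)
  then show ?thesis unfolding K_def c_def by simp
qed

section \<open>Exchange arguments: every FC serves an AP of positive mass\<close>

lemma weighted_UN_partition:
  assumes "region_partition N \<Omega> R" and "region B" and "I \<subseteq> {1..N}" and "continuous_on UNIV g"
  shows "weighted (\<Union>i\<in>I. R i \<inter> B) g = (\<Sum>i\<in>I. weighted (R i \<inter> B) g)"
proof (rule set_integral_finite_Union)
  show "finite I" using assms(3) finite_subset by blast
  show "disjoint_family_on (\<lambda>i. R i \<inter> B) I"
    using assms(1,3) unfolding region_partition_def disjoint_family_on_def by blast
  show "R i \<inter> B \<in> sets lborel" if "i \<in> I" for i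
    using that assms(2,3) partition_region[OF assms(1), of i] by (auto simp: subset_iff)
  then show "set_integrable lborel (R i \<inter> B) (\<lambda>w. g w * f w)" if "i \<in> I" for i
    using that assms by (intro set_integrable_weighted) auto
qed

text \<open>AP \<open>k\<close> and FC \<open>m\<close> can be moved at no cost. Placed together at
  \<open>w0\<close> they have no second-tier cost, and \<open>k\<close> then serves points near
  \<open>w0\<close> more cheaply than any other AP does.\<close>

lemma idle_pair_not_optimal:
  assumes opt: "optimal_deployment N M \<Omega> a b \<beta> f P Q R T"
    and k: "k \<in> {1..N}" "R k \<in> null_sets lborel"
    and m: "m \<in> {1..M}" "\<And>i. i \<in> {1..N} \<Longrightarrow> T i = m \<Longrightarrow> R i \<in> null_sets lborel"
  shows False
proof -
  note part = optimalD(1)[OF opt]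
  note R = partition_region[OF part]
  let ?I = "{1..N} - {k}"
  \<comment> \<open>A nonempty open set is infinite, so finitely many AP positions do not exhaust
    it.\<close>
  have "infinite (interior \<Omega>)"
    using finite_imp_not_open interior_\<Omega> open_interior by blast
  then have "\<not> interior \<Omega> \<subseteq> P ` {1..N}"
    using finite_subset by blast
  then obtain w0 where w0: "w0 \<in> interior \<Omega>" "w0 \<notin> P ` {1..N}" by blast
  let ?h = "\<lambda>w. a k * (norm (w0 - w))^2"
  \<comment> \<open>\<open>B\<close> is where \<open>k\<close>, moved to \<open>w0\<close>, beats
    the first-tier cost of every other AP. At \<open>w0\<close> its own cost is zero and the others
    are positive, so the open set \<open>B\<close> is nonempty.\<close>
  define B where "B = interior \<Omega> \<inter> (\<Inter>i\<in>?I. {w. ?h w < a i * (norm (P i - w))^2})"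
  have "open B"
    unfolding B_def by (intro open_Int open_INT ballI open_interior open_Collect_less
        continuous_intros) auto
  moreover have "0 < a i * (norm (P i - w0))^2" if "i \<in> ?I" for i
    using that w0 a_pos by (intro mult_pos_pos) auto
  then have "w0 \<in> B"
    using w0 by (auto simp: B_def)
  ultimately have B_nonnull: "B \<notin> null_sets lborel"
    using open_not_negligible[of B] null_sets_completionI[of B lborel]
    by (auto simp: negligible_iff_null_sets)
  have B: "region B" "B \<subseteq> \<Omega>"
    using \<open>open B\<close> interior_subset by (auto simp: B_def)
  have cover: "B = (\<Union>i\<in>{1..N}. R i \<inter> B)"
    using part B unfolding region_partition_def by blast
  have disj: "R i \<inter> R j = {}" if "i \<in> {1..N}" "j \<in> {1..N}" "i \<noteq> j" for i j
    using part that unfolding region_partition_def disjoint_family_on_def by blast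
  define R' P' Q' T' where "R' = (\<lambda>i. if i = k then R k \<union> B else R i - B)"
    and "P' = P(k := w0)" and "Q' = Q(m := w0)" and "T' = T(k := m)"
  have "region_partition N \<Omega> R'"
    unfolding region_partition_def
  proof (intro conjI ballI)
    show "R' n \<in> sets borel" if "n \<in> {1..N}" for n
      using that R B k by (auto simp: R'_def)
    show "disjoint_family_on R' {1..N}"
      unfolding disjoint_family_on_def
    proof (intro ballI impI)
      fix i j assume "i \<in> {1..N}" "j \<in> {1..N}" "i \<noteq> j"
      then show "R' i \<inter> R' j = {}"
        using disj[of i j] disj[of i k] disj[of k j] k(1) by (auto simp: R'_def)
    qed
    show "(\<Union>n\<in>{1..N}. R' n) = \<Omega>"
    proof
      show "(\<Union>n\<in>{1..N}. R' n) \<subseteq> \<Omega>"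
      proof
        fix w assume "w \<in> (\<Union>n\<in>{1..N}. R' n)"
        then obtain i where "i \<in> {1..N}" "w \<in> R' i" by blast
        then show "w \<in> \<Omega>" using R[of i] B by (auto simp: R'_def split: if_splits)
      qed
      show "\<Omega> \<subseteq> (\<Union>n\<in>{1..N}. R' n)"
      proof
        fix w assume "w \<in> \<Omega>"
        then obtain i where "i \<in> {1..N}" "w \<in> R i"
          using part unfolding region_partition_def by blast
        then show "w \<in> (\<Union>n\<in>{1..N}. R' n)"
          using k by (cases "w \<in> B \<or> i = k") (auto simp: R'_def)
      qed
    qed
  qed
  moreover have "T' \<in> {1..N} \<rightarrow> {1..M}"
    using optimalD(2)[OF opt] m by (auto simp: T'_def)
  ultimately have le: "two_tier_distortion N a b \<beta> f P Q R T \<le> two_tier_distortion N a b \<beta> f P' Q' R' T'"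
    by (rule optimalD(3)[OF opt])
  have h_cont: "continuous_on UNIV ?h" by (intro continuous_intros)
  have old: "two_tier_distortion N a b \<beta> f P Q R T
      = (\<Sum>i\<in>?I. weighted (R i - B) (cost P Q T i)) + (\<Sum>i\<in>?I. weighted (R i \<inter> B) (cost P Q T i))"
  proof -
    have "weighted (R i) (cost P Q T i)
        = weighted (R i - B) (cost P Q T i) + weighted (R i \<inter> B) (cost P Q T i)" if "i \<in> ?I" for i
      using weighted_Un[of "R i - B" "R i \<inter> B" "cost P Q T i"] R[of i] B that
      by (auto simp: continuous_cost Un_Diff_Int)
    then show ?thesis
      unfolding distortion_eq sum_remove_AP[OF k(1)] weighted_null[OF k(2)]
      by (simp add: sum.distrib)
  qed
  have new: "two_tier_distortion N a b \<beta> f P' Q' R' T'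
      = (\<Sum>i\<in>?I. weighted (R i - B) (cost P Q T i)) + (\<Sum>i\<in>?I. weighted (R i \<inter> B) ?h)"
  proof -
    have "weighted (R' i) (cost P' Q' T' i) = weighted (R i - B) (cost P Q T i)" if i: "i \<in> ?I" for i
    \<comment> \<open>Moving \<open>Q m\<close> alters the cost function of an AP assigned to
      \<open>m\<close>, but its region is null, so both integrals vanish.\<close>
    proof (cases "T i = m")
      case True
      then have "R i - B \<in> null_sets lborel"
        using m(2)[of i] i B by (intro null_set_Diff) auto
      then show ?thesis using i by (simp add: R'_def weighted_null)
    next
      case False
      then show ?thesis using i by (simp add: R'_def P'_def Q'_def T'_def cost_def)
    qed
    moreover have "weighted (R' k) (cost P' Q' T' k) = (\<Sum>i\<in>?I. weighted (R i \<inter> B) ?h)"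
    proof -
      \<comment> \<open>With \<open>P' k\<close> and its FC both at \<open>w0\<close>, the cost is
        \<open>?h\<close>. The union is rewritten as a disjoint one for additivity.\<close>
      have "weighted (R' k) (cost P' Q' T' k) = weighted (R k \<union> (B - R k)) ?h"
        by (simp add: R'_def P'_def Q'_def T'_def cost_def)
      also have "\<dots> = weighted (R k) ?h + weighted (B - R k) ?h"
        using R[OF k(1)] B h_cont by (intro weighted_Un) auto
      also have "weighted (R k) ?h = 0" by (rule weighted_null[OF k(2)])
      also have "B - R k = (\<Union>i\<in>?I. R i \<inter> B)"
        using cover disj k by blast
      also have "weighted \<dots> ?h = (\<Sum>i\<in>?I. weighted (R i \<inter> B) ?h)"
        using part B h_cont by (intro weighted_UN_partition) auto
      finally show ?thesis by simp
    qed
    ultimately show ?thesis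
      unfolding distortion_eq sum_remove_AP[OF k(1)] by simp
  qed
  have less: "?h w < cost P Q T i w" if "i \<in> ?I" "w \<in> R i \<inter> B" for i w
  proof -
    have "T i \<in> {1..M}" using that optimalD(2)[OF opt] by blast
    then have "0 \<le> \<beta> * b i (T i) * (norm (P i - Q (T i)))^2"
      using b_pos[of i "T i"] \<beta>_pos that by auto
    moreover have "?h w < a i * (norm (P i - w))^2" using that by (auto simp: B_def)
    ultimately show ?thesis by (simp add: cost_def)
  qed
  have RB: "region (R i \<inter> B)" if "i \<in> ?I" for i using R[of i] B that by auto
  \<comment> \<open>\<open>B\<close> is not null and is covered by finitely many pieces, of which
    that of \<open>k\<close> is null; another piece therefore gives a strict saving.\<close>
  obtain j where j: "j \<in> ?I" "R j \<inter> B \<notin> null_sets lborel"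
  proof -
    have "\<exists>i\<in>?I. R i \<inter> B \<notin> null_sets lborel"
    proof (rule ccontr)
      assume "\<not> ?thesis"
      then have "R i \<inter> B \<in> null_sets lborel" if "i \<in> {1..N}" for i
        using that k B by (cases "i = k") (auto intro: null_set_Int2)
      then have "(\<Union>i\<in>{1..N}. R i \<inter> B) \<in> null_sets lborel"
        by (intro null_sets.finite_UN) auto
      then show False using cover B_nonnull by simp
    qed
    then show ?thesis using that by blast
  qed
  have "(\<Sum>i\<in>?I. weighted (R i \<inter> B) ?h) < (\<Sum>i\<in>?I. weighted (R i \<inter> B) (cost P Q T i))"
  proof (rule sum_strict_mono_ex1)
    show "\<forall>i\<in>?I. weighted (R i \<inter> B) ?h \<le> weighted (R i \<inter> B) (cost P Q T i)"
    proof
      fix i assume i: "i \<in> ?I"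
      show "weighted (R i \<inter> B) ?h \<le> weighted (R i \<inter> B) (cost P Q T i)"
        by (rule weighted_mono[OF RB[OF i] h_cont continuous_cost less_imp_le[OF less[OF i]]])
    qed
    have "weighted (R j \<inter> B) ?h < weighted (R j \<inter> B) (cost P Q T j)"
      by (rule weighted_strict_mono[OF RB[OF j(1)] h_cont continuous_cost less[OF j(1)] j(2)])
    then show "\<exists>i\<in>?I. weighted (R i \<inter> B) ?h < weighted (R i \<inter> B) (cost P Q T i)"
      using j(1) by blast
  qed simp
  then show False using le old new by simp
qed

text \<open>Otherwise, moving \<open>Q m\<close> onto \<open>P n\<close> and assigning
  \<open>n\<close> to \<open>m\<close> saves a positive second-tier cost, and no other AP notices
  because none uses \<open>m\<close>.\<close>

lemma optimal_unused_FC_imp_coincide: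
  assumes opt: "optimal_deployment N M \<Omega> a b \<beta> f P Q R T"
    and m: "m \<in> {1..M}" "\<And>i. i \<in> {1..N} \<Longrightarrow> T i \<noteq> m"
    and n: "n \<in> {1..N}" "R n \<notin> null_sets lborel"
  shows "P n = Q (T n)"
proof (rule ccontr)
  assume neq: "P n \<noteq> Q (T n)"
  have R: "region (R n)" using partition_region optimalD(1)[OF opt] n by blast
  have "weighted (R n) (cost P Q T n) \<le> weighted (R n) (cost P (Q(m := P n)) (T(n := m)) n)"
    using optimalD(2)[OF opt] m(1) m(2)
    by (intro optimal_weighted_le[OF opt n(1)]) (auto simp: cost_def)
  moreover have "T n \<in> {1..M}" using optimalD(2)[OF opt] n by blast
  then have "0 < \<beta> * b n (T n) * (norm (P n - Q (T n)))^2 * region_mass f (R n)"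
    using neq \<beta>_pos b_pos[OF n(1)] region_mass_pos_iff[OF R] n(2) by (intro mult_pos_pos) auto
  ultimately show False by (simp add: weighted_cost_eq[OF R])
qed

text \<open>At a common position, and with \<open>k\<close> on its own FC, \<open>k\<close> serves
  each point at most as expensively as \<open>l\<close>. The merged deployment thus stays optimal,
  now with an empty region for \<open>l\<close>.\<close>

lemma optimal_merge:
  assumes opt: "optimal_deployment N M \<Omega> a b \<beta> f P Q R T"
    and k: "k \<in> {1..N}" and l: "l \<in> {1..N}" and "k \<noteq> l"
    and le: "a k \<le> a l" and "P k = Q (T k)" and "P l = P k"
  shows "optimal_deployment N M \<Omega> a b \<beta> f P Q (R(k := R k \<union> R l, l := {})) T"
proof -
  let ?R = "R(k := R k \<union> R l, l := {})"
  let ?J = "{1..N} - {k} - {l}"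
  note part = optimalD(1)[OF opt]
  note R = partition_region[OF part]
  have disj: "R i \<inter> R j = {}" if "i \<in> {1..N}" "j \<in> {1..N}" "i \<noteq> j" for i j
    using part that unfolding region_partition_def disjoint_family_on_def by blast
  have "region_partition N \<Omega> ?R"
    unfolding region_partition_def
  proof (intro conjI ballI)
    show "?R n \<in> sets borel" if "n \<in> {1..N}" for n
      using that R k l by auto
    show "disjoint_family_on ?R {1..N}"
      unfolding disjoint_family_on_def
    proof (intro ballI impI)
      fix i j assume "i \<in> {1..N}" "j \<in> {1..N}" "i \<noteq> j"
      then show "?R i \<inter> ?R j = {}"
        using disj[of i j] disj[of k j] disj[of l j] disj[of i k] disj[of i l] k l by auto
    qed
    have "(\<Union>n\<in>{1..N}. ?R n) = (\<Union>n\<in>{1..N}. R n)"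
      using k l \<open>k \<noteq> l\<close> by (auto split: if_splits)
    then show "(\<Union>n\<in>{1..N}. ?R n) = \<Omega>" using part unfolding region_partition_def by simp
  qed
  moreover have "two_tier_distortion N a b \<beta> f P Q ?R T \<le> two_tier_distortion N a b \<beta> f P Q R T"
  proof -
    have split: "(\<Sum>n=1..N. g n) = g k + (g l + (\<Sum>n\<in>?J. g n))" for g :: "nat \<Rightarrow> real"
      unfolding sum_remove_AP[OF k] using l \<open>k \<noteq> l\<close> sum.remove[of "{1..N} - {k}" l g] by simp
    have "T l \<in> {1..M}" using optimalD(2)[OF opt] l by blast
    then have "0 \<le> \<beta> * b l (T l) * (norm (P k - Q (T l)))^2"
      using b_pos[OF l, of "T l"] \<beta>_pos by auto
    then have "cost P Q T k w \<le> cost P Q T l w" for w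
      using le \<open>P k = Q (T k)\<close> \<open>P l = P k\<close> mult_right_mono[OF le, of "(norm (P k - w))^2"]
      by (simp add: cost_def)
    then have "weighted (R l) (cost P Q T k) \<le> weighted (R l) (cost P Q T l)"
      using R[OF l] by (intro weighted_mono continuous_cost) auto
    moreover have "weighted (R k \<union> R l) (cost P Q T k)
        = weighted (R k) (cost P Q T k) + weighted (R l) (cost P Q T k)"
      using R[OF k] R[OF l] disj[OF k l \<open>k \<noteq> l\<close>] by (intro weighted_Un continuous_cost) auto
    ultimately show ?thesis
      unfolding distortion_eq split using \<open>k \<noteq> l\<close> weighted_null[of "{}"] by simp
  qed
  ultimately show ?thesis
    using opt unfolding optimal_deployment_def by (meson order_trans)
qed

text \<open>This is what makes the denominator in the FC equation positive.\<close>

lemma optimal_FC_used: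
  assumes opt: "optimal_deployment N M \<Omega> a b \<beta> f P Q R T" and m: "m \<in> {1..M}"
  shows "\<exists>j\<in>{1..N}. T j = m \<and> R j \<notin> null_sets lborel"
proof (rule ccontr)
  assume "\<not> ?thesis"
  then have idle: "R i \<in> null_sets lborel" if "i \<in> {1..N}" "T i = m" for i
    using that by blast
  \<comment> \<open>A null region would complete an idle pair with \<open>m\<close>. Hence all
    regions are non-null, and no AP at all is assigned to \<open>m\<close>.\<close>
  have nonnull: "R i \<notin> null_sets lborel" if "i \<in> {1..N}" for i
    using idle_pair_not_optimal[OF opt that _ m idle] by blast
  then have unused: "T i \<noteq> m" if "i \<in> {1..N}" for i
    using idle that by blast
  \<comment> \<open>Without \<open>m\<close> only \<open>M - 1\<close> FCs remain for
    \<open>N\<close> APs, and \<open>M - 1 < N\<close>.\<close>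
  have "T ` {1..N} \<subseteq> {1..M} - {m}"
    using optimalD(2)[OF opt] unused by blast
  then have "card (T ` {1..N}) \<le> card ({1..M} - {m})"
    by (intro card_mono) auto
  also have "\<dots> < card {1..N}"
    using m M_le_N by auto
  finally have "\<not> inj_on T {1..N}"
    by (rule pigeonhole)
  then obtain k l where kl: "k \<in> {1..N}" "l \<in> {1..N}" "k \<noteq> l" "T k = T l"
    unfolding inj_on_def by blast
  have at_FC: "P n = Q (T n)" if "n \<in> {1..N}" for n
    using optimal_unused_FC_imp_coincide[OF opt m unused] that nonnull by blast
  \<comment> \<open>Generalized over \<open>k\<close> and \<open>l\<close>, so that the two may be
    swapped to put the smaller weight first.\<close>
  have False if kl: "k \<in> {1..N}" "l \<in> {1..N}" "k \<noteq> l" "T k = T l" and "a k \<le> a l" for k l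
  proof -
    have "optimal_deployment N M \<Omega> a b \<beta> f P Q (R(k := R k \<union> R l, l := {})) T"
      using that at_FC by (intro optimal_merge[OF opt]) auto
    then show False
      using kl m unused by (rule_tac idle_pair_not_optimal[of _ _ _ _ l m]) auto
  qed
  then show False using kl by (metis linear)
qed

end

text \<open>The AP equation is guarded because a region of zero mass has no centroid, and its AP
  contributes nothing wherever it is placed. For the FC equation, positivity of the denominator is
  proved from optimality.\<close>

theorem proposition2:
  fixes N M :: nat
    and \<Omega> :: "(real^2) set"
    and f :: "real^2 \<Rightarrow> real"
    and a :: "nat \<Rightarrow> real"
    and b :: "nat \<Rightarrow> nat \<Rightarrow> real"
    and \<beta> :: real
    and P Q :: "nat \<Rightarrow> real^2"
    and R :: "nat \<Rightarrow> (real^2) set"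
    and T :: "nat \<Rightarrow> nat"
  assumes "1 \<le> M" and "M \<le> N"
    and "convex_polygon \<Omega>"
    and "continuous_on \<Omega> f" and "f differentiable_on \<Omega>"
    and "\<And>w. w \<in> \<Omega> \<Longrightarrow> 0 < f w"
    and "\<And>n. n \<in> {1..N} \<Longrightarrow> 0 < a n"
    and "\<And>n m. n \<in> {1..N} \<Longrightarrow> m \<in> {1..M} \<Longrightarrow> 0 < b n m"
    and "0 < \<beta>"
    and "optimal_deployment N M \<Omega> a b \<beta> f P Q R T"
  shows "\<forall>n\<in>{1..N}. \<forall>m\<in>{1..M}.
    (region_mass f (R n) \<noteq> 0 \<longrightarrow>
       P n = (a n *\<^sub>R region_centroid f (R n) + (\<beta> * b n (T n)) *\<^sub>R Q (T n))
               /\<^sub>R (a n + \<beta> * b n (T n))) \<and>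
    Q m = (\<Sum>k | k \<in> {1..N} \<and> T k = m. (b k m * region_mass f (R k)) *\<^sub>R P k)
            /\<^sub>R (\<Sum>k | k \<in> {1..N} \<and> T k = m. b k m * region_mass f (R k))"
proof -
  interpret two_tier_network N M \<Omega> f a b \<beta>
    using assms by unfold_locales
      (auto simp: convex_polygon_def polytope_imp_compact)
  note opt = assms(10)
  show ?thesis
  proof (intro ballI conjI impI)
    fix n m assume n: "n \<in> {1..N}" and m: "m \<in> {1..M}"
    show "P n = (a n *\<^sub>R region_centroid f (R n) + (\<beta> * b n (T n)) *\<^sub>R Q (T n))
        /\<^sub>R (a n + \<beta> * b n (T n))" if "region_mass f (R n) \<noteq> 0"
      using optimal_AP_eq[OF opt n that] .
    obtain j where j: "j \<in> {1..N}" "T j = m" "R j \<notin> null_sets lborel"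
      using optimal_FC_used[OF opt m] by blast
    have mass: "region_mass f (R j) \<noteq> 0"
      using region_mass_pos_iff[OF partition_region[OF optimalD(1)[OF opt] j(1)]] j(3) by simp
    show "Q m = (\<Sum>k | k \<in> {1..N} \<and> T k = m. (b k m * region_mass f (R k)) *\<^sub>R P k)
        /\<^sub>R (\<Sum>k | k \<in> {1..N} \<and> T k = m. b k m * region_mass f (R k))"
      by (rule optimal_FC_eq[OF opt m j(1,2) mass])
  qed
qed

end
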